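(* Let $k\in\{0,1,2\}$, $A(t)\in M_m(C^1[t_0,+\infty))$ and $B(t)\in M_m(C[t_0,+\infty))$. The system $\ddot{\mathbf x}+A(t)\dot{\mathbf x}+B(t)\mathbf x=0$ is $L_k$-equivalent to some system $\ddot{\xi}+V(t)\dot{\xi}+W(t)\xi=0$ with $V(t)=V^T(t)$ for all $t\ge t_0$ if and only if there exist a symmetric matrix function $S(t)=S^T(t)\in M_m(C^1[t_0,+\infty))$ and a symmetric positive definite matrix $S_0\in M_m(\mathbb R)$ such that, with $$\Lambda(t)=2\int_{t_0}^{t}S(\nu)\,d\nu+S_0,\qquad K(t)=\tfrac14\left(\Lambda(t)A^T(t)-A(t)\Lambda(t)\right),$$ the following conditions hold: (1) there are constants $\mu>0$, $\eta>0$ such that for all $t\in[t_0,+\infty)$ $$\left|2\int_{t_0}^{t}\mathrm{Tr}(S(\nu))\,d\nu+\mathrm{Tr}(S_0)\right|\le\mu^2,\qquad \det\left(2\int_{t_0}^{t}S(\nu)\,d\nu+S_0\right)\ge\eta^2;$$ (2) if $k\ne 0$, then for every $i\in\{0,\dots,k-1\}$ $$\sup_{t\in[t_0,+\infty)}\left\|\frac{d^i}{dt^i}K(t)\right\|+\sup_{t\in[t_0,+\infty)}\left\|\frac{d^i}{dt^i}S(t)\right\|<+\infty$$ (for $k=0$ condition (2) is omitted).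
   Context: $M_m(C^i[t_0,+\infty))$ is the space of $m\times m$ matrices whose entries are real-valued $C^i$ functions on $[t_0,+\infty)$ ($C=C^0$); $M_m(\mathbb R)$ is the space of real $m\times m$ matrices; $\|\cdot\|$ is a matrix norm. For $k\in\{0,1,2\}$, a matrix $L(t)\in M_m(C^2[t_0,+\infty))$ is an $L_k$-matrix if there is $\eta>0$ with $|\det L(t)|>\eta$ for all $t\in[t_0,+\infty)$ and $\sup_{t\ge t_0}\left\|\frac{d^i}{dt^i}L(t)\right\|<+\infty$ for all $i=0,\dots,k$. The system $\ddot{\mathbf x}+A(t)\dot{\mathbf x}+B(t)\mathbf x=0$ is $L_k$-equivalent to the system $\ddot\xi+V(t)\dot\xi+W(t)\xi=0$ (with $A,B,V,W\in M_m(C[t_0,+\infty))$) if there exists an $L_k$-matrix $L(t)$ such that for all $t\ge t_0$ $$V=L^{-1}(2\dot L+AL),\qquad W=L^{-1}(\ddot L+A\dot L+BL).$$ *)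

theory Defs
  imports "HOL-Analysis.Analysis"
begin

(* Iterated derivative on the closed half-line {t0..}: at the endpoint t0 it is the
   one-sided derivative.  The values of f outside {t0..} play no role at points of {t0..}. *)
primrec nth_deriv :: "real \<Rightarrow> nat \<Rightarrow> (real \<Rightarrow> 'a::real_normed_vector) \<Rightarrow> real \<Rightarrow> 'a" where
  "nth_deriv t0 0 f = f"
| "nth_deriv t0 (Suc n) f = (\<lambda>t. vector_derivative (nth_deriv t0 n f) (at t within {t0..}))"

definition C_on :: "nat \<Rightarrow> real \<Rightarrow> (real \<Rightarrow> real) \<Rightarrow> bool" where
  "C_on n t0 f \<longleftrightarrow>
     (\<forall>j<n. \<forall>t\<ge>t0. nth_deriv t0 j f differentiable (at t within {t0..})) \<and>
     continuous_on {t0..} (nth_deriv t0 n f)"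

definition matC_on :: "nat \<Rightarrow> real \<Rightarrow> (real \<Rightarrow> real^'m^'m) \<Rightarrow> bool" where
  "matC_on n t0 F \<longleftrightarrow> (\<forall>i j. C_on n t0 (\<lambda>t. F t $ i $ j))"

(* The norm on real^'m^'m is the Frobenius norm; since all matrix norms are equivalent,
   the choice does not affect boundedness. *)
definition Lk_matrix :: "nat \<Rightarrow> real \<Rightarrow> (real \<Rightarrow> real^'m^'m) \<Rightarrow> bool" where
  "Lk_matrix k t0 L \<longleftrightarrow>
     matC_on 2 t0 L \<and>
     (\<exists>\<eta>>0. \<forall>t\<ge>t0. \<bar>det (L t)\<bar> > \<eta>) \<and>
     (\<forall>i\<in>{0..k}. bdd_above ((\<lambda>t. norm (nth_deriv t0 i L t)) ` {t0..}))"

(* The pair (A, B) stands for the system x'' + A(t) x' + B(t) x = 0 on {t0..},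
   and (V, W) for the system y'' + V(t) y' + W(t) y = 0. *)
definition Lk_equivalent ::
    "nat \<Rightarrow> real \<Rightarrow> (real \<Rightarrow> real^'m^'m) \<Rightarrow> (real \<Rightarrow> real^'m^'m) \<Rightarrow>
     (real \<Rightarrow> real^'m^'m) \<Rightarrow> (real \<Rightarrow> real^'m^'m) \<Rightarrow> bool" where
  "Lk_equivalent k t0 A B V W \<longleftrightarrow>
     matC_on 0 t0 A \<and> matC_on 0 t0 B \<and> matC_on 0 t0 V \<and> matC_on 0 t0 W \<and>
     (\<exists>L. Lk_matrix k t0 L \<and>
        (\<forall>t\<ge>t0.
           V t = matrix_inv (L t) ** (2 *\<^sub>R nth_deriv t0 1 L t + A t ** L t) \<and>
           W t = matrix_inv (L t) ** (nth_deriv t0 2 L t + A t ** nth_deriv t0 1 L t + B t ** L t)))"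

definition symmetric_matrix :: "real^'m^'m \<Rightarrow> bool" where
  "symmetric_matrix M \<longleftrightarrow> transpose M = M"

definition positive_definite_matrix :: "real^'m^'m \<Rightarrow> bool" where
  "positive_definite_matrix M \<longleftrightarrow> (\<forall>x. x \<noteq> 0 \<longrightarrow> x \<bullet> (M *v x) > 0)"

definition Lambda_mat ::
    "real \<Rightarrow> (real \<Rightarrow> real^'m^'m) \<Rightarrow> real^'m^'m \<Rightarrow> real \<Rightarrow> real^'m^'m" where
  "Lambda_mat t0 S S0 t = 2 *\<^sub>R integral {t0..t} S + S0"

definition K_mat ::
    "real \<Rightarrow> (real \<Rightarrow> real^'m^'m) \<Rightarrow> (real \<Rightarrow> real^'m^'m) \<Rightarrow> real^'m^'m \<Rightarrow> real \<Rightarrow> real^'m^'m" where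
  "K_mat t0 A S S0 t =
     (1/4) *\<^sub>R (Lambda_mat t0 S S0 t ** transpose (A t) - A t ** Lambda_mat t0 S S0 t)"

end

theory Submission
  imports Defs
begin

text \<open>
  Put \<open>\<Lambda> = L L\<^sup>T\<close>. The matrix \<open>V = L\<^sup>-\<^sup>1 (2 L' + A L)\<close> is symmetric iff \<open>L V L\<^sup>T = 2 L' L\<^sup>T + A \<Lambda>\<close> is,
  that is, iff the antisymmetric part of \<open>L' L\<^sup>T\<close> equals \<open>K = (\<Lambda> A\<^sup>T - A \<Lambda>) / 4\<close>; its symmetric
  part \<open>S\<close> is always \<open>\<Lambda>' / 2\<close>. So an admissible \<open>L\<close> yields \<open>S\<close> and \<open>K\<close>, and conversely \<open>L\<close> is
  recovered from \<open>S\<close> as the solution of the linear equation \<open>L' = (S + K) \<Lambda>\<^sup>-\<^sup>1 L\<close> with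
  \<open>L(t0) L(t0)\<^sup>T = S0\<close>: along it \<open>L\<^sup>T \<Lambda>\<^sup>-\<^sup>1 L\<close> is constant, whence \<open>L L\<^sup>T = \<Lambda>\<close>. The bounds
  correspond through \<open>Tr \<Lambda> = \<parallel>L\<parallel>\<^sup>2\<close> and \<open>det \<Lambda> = (det L)\<^sup>2\<close>.
\<close>

subsection \<open>Functions of class C^n on a half-line\<close>

text \<open>Limits of difference quotients pass through coordinate projections and products; the
  entrywise criterion for derivatives and the derivative of an inverse matrix both rest on this
  form.\<close>

lemma has_vector_derivative_iff_tendsto_quotient:
  "(f has_vector_derivative f') (at x within S) \<longleftrightarrow>
   ((\<lambda>y. (f y - f x) /\<^sub>R (y - x)) \<longlongrightarrow> f') (at x within S)"
proof -
  have "norm (f y - f x - (y - x) *\<^sub>R f') / norm (y - x) = norm ((f y - f x) /\<^sub>R (y - x) - f')"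
    if "y \<noteq> x" for y
  proof -
    have "(f y - f x) /\<^sub>R (y - x) - f' = (f y - f x - (y - x) *\<^sub>R f') /\<^sub>R (y - x)"
      using that by (simp add: scaleR_diff_right)
    then show ?thesis by (simp add: divide_inverse_commute)
  qed
  then have "((\<lambda>y. norm (f y - f x - (y - x) *\<^sub>R f') / norm (y - x)) \<longlongrightarrow> 0) (at x within S) \<longleftrightarrow>
      ((\<lambda>y. norm ((f y - f x) /\<^sub>R (y - x) - f')) \<longlongrightarrow> 0) (at x within S)"
    by (intro filterlim_cong) (auto simp: eventually_at_filter)
  then show ?thesis
    unfolding has_vector_derivative_def has_derivative_iff_norm tendsto_norm_zero_iff
    by (simp add: LIM_zero_iff bounded_linear_scaleR_left)
qed

lemma has_vector_derivative_vec_iff: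
  fixes f :: "real \<Rightarrow> 'a::real_normed_vector^'n"
  shows "(f has_vector_derivative f') (at x within S) \<longleftrightarrow>
    (\<forall>i. ((\<lambda>t. f t $ i) has_vector_derivative f' $ i) (at x within S))"
  unfolding has_vector_derivative_iff_tendsto_quotient
  by (auto intro: vec_tendstoI dest: tendsto_vec_nth)

lemma continuous_on_vec_iff:
  fixes f :: "'b::topological_space \<Rightarrow> 'a::real_normed_vector^'n"
  shows "continuous_on S f \<longleftrightarrow> (\<forall>i. continuous_on S (\<lambda>t. f t $ i))"
  unfolding continuous_on_def by (auto intro: vec_tendstoI tendsto_vec_nth)

text \<open>Every \<open>t \<ge> t0\<close> is a limit point of the half-line, at \<open>t0\<close>
  from one side only. Derivatives within it are therefore unique, and
  \<open>vector_derivative\<close> returns the one exhibited.\<close>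

lemma at_within_atLeast_neq_bot: "t \<ge> t0 \<Longrightarrow> at (t::real) within {t0..} \<noteq> bot"
  using islimpt_subset[of t "{t..t + 1}" "{t0..}"] by (auto simp: trivial_limit_within islimpt_Icc)

text \<open>Differentiability is local: a margin of one unit to the right of \<open>t\<close>
  transfers statements on compact intervals to the half-line, also at the left endpoint.\<close>

lemma at_within_atLeastAtMost: "a \<le> t \<Longrightarrow> at (t::real) within {a..t + 1} = at t within {a..}"
  by (intro at_within_nhd[of _ "{..<t+1}"]) auto

text \<open>\<open>vector_derivative\<close> chooses among the derivatives within the half-line.
  Functions agreeing there have the same candidates, hence the same chosen value, even at points
  where no derivative exists.\<close>

lemma nth_deriv_cong:
  "(\<And>s. s \<ge> t0 \<Longrightarrow> f s = g s) \<Longrightarrow> t \<ge> t0 \<Longrightarrow> nth_deriv t0 n f t = nth_deriv t0 n g t"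
proof (induction n arbitrary: t)
  case (Suc n)
  have eq: "nth_deriv t0 n f s = nth_deriv t0 n g s" if "s \<ge> t0" for s
    using Suc.IH[OF Suc.prems(1) that] .
  have "(nth_deriv t0 n f has_vector_derivative y) (at t within {t0..}) \<longleftrightarrow>
      (nth_deriv t0 n g has_vector_derivative y) (at t within {t0..})" for y
    using eq Suc.prems(2)
    by (intro iffI; elim has_vector_derivative_transform[rotated 2]) auto
  then show ?case by (simp add: vector_derivative_def)
qed auto

text \<open>\<open>nth_deriv\<close> adds derivatives on the outside; characterising smoothness
  through the first derivative requires taking one off the inside.\<close>

lemma nth_deriv_Suc_shift:
  "nth_deriv t0 (Suc n) f = nth_deriv t0 n (nth_deriv t0 (Suc 0) f)"
  by (induction n) auto

lemma nth_deriv_Suc_eq: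
  assumes "\<And>s. s \<ge> t0 \<Longrightarrow> (f has_vector_derivative f' s) (at s within {t0..})" "t \<ge> t0"
  shows "nth_deriv t0 (Suc n) f t = nth_deriv t0 n f' t"
  unfolding nth_deriv_Suc_shift[of t0 n]
  using assms by (intro nth_deriv_cong) (auto intro!: vector_derivative_within at_within_atLeast_neq_bot)

lemma C_on_cong:
  assumes eq: "\<And>s. s \<ge> t0 \<Longrightarrow> f s = g s" and f: "C_on n t0 f"
  shows "C_on n t0 g"
proof -
  have nth: "nth_deriv t0 j f t = nth_deriv t0 j g t" if "t \<ge> t0" for j t
    using nth_deriv_cong[OF eq that] .
  have "nth_deriv t0 j g differentiable (at t within {t0..})" if "j < n" "t \<ge> t0" for j t
  proof (rule differentiable_transform_within)
    show "nth_deriv t0 j f differentiable (at t within {t0..})"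
      using f that by (simp add: C_on_def)
  qed (use that nth in \<open>auto intro: zero_less_one\<close>)
  moreover have "continuous_on {t0..} (nth_deriv t0 n g)"
    using f nth continuous_on_cong[of "{t0..}" "{t0..}" "nth_deriv t0 n f" "nth_deriv t0 n g"]
    by (simp add: C_on_def)
  ultimately show ?thesis by (simp add: C_on_def)
qed

text \<open>A recursion on smoothness through an arbitrary derivative function: explicit derivatives
  can be supplied, and by uniqueness they agree with \<open>nth_deriv\<close> on the
  half-line.\<close>

lemma C_on_Suc_iff:
  "C_on (Suc n) t0 f \<longleftrightarrow>
   (\<exists>f'. (\<forall>t\<ge>t0. (f has_vector_derivative f' t) (at t within {t0..})) \<and> C_on n t0 f')"
proof
  assume f: "C_on (Suc n) t0 f"
  have "(f has_vector_derivative nth_deriv t0 (Suc 0) f t) (at t within {t0..})" if "t \<ge> t0" for t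
  proof -
    have "nth_deriv t0 0 f differentiable (at t within {t0..})"
      using f that unfolding C_on_def by blast
    then show ?thesis by (simp add: vector_derivative_works)
  qed
  moreover have "C_on n t0 (nth_deriv t0 (Suc 0) f)"
    using f unfolding C_on_def nth_deriv_Suc_shift[symmetric] by blast
  ultimately show "\<exists>f'. (\<forall>t\<ge>t0. (f has_vector_derivative f' t) (at t within {t0..})) \<and> C_on n t0 f'"
    by blast
next
  assume "\<exists>f'. (\<forall>t\<ge>t0. (f has_vector_derivative f' t) (at t within {t0..})) \<and> C_on n t0 f'"
  then obtain f' where f': "\<And>t. t \<ge> t0 \<Longrightarrow> (f has_vector_derivative f' t) (at t within {t0..})"
    and "C_on n t0 f'" by blast
  have "f' s = nth_deriv t0 (Suc 0) f s" if "s \<ge> t0" for s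
    using nth_deriv_Suc_eq[OF f' that, of 0] by simp
  from C_on_cong[OF this \<open>C_on n t0 f'\<close>] have C: "C_on n t0 (nth_deriv t0 (Suc 0) f)" .
  have "nth_deriv t0 j f differentiable (at t within {t0..})" if "j < Suc n" "t \<ge> t0" for j t
  proof (cases j)
    case 0
    then show ?thesis using f'[OF that(2)] by (simp add: differentiableI_vector)
  next
    case (Suc i)
    then show ?thesis using C that unfolding C_on_def nth_deriv_Suc_shift[symmetric] by simp
  qed
  with C show "C_on (Suc n) t0 f"
    unfolding C_on_def nth_deriv_Suc_shift[symmetric] by blast
qed

section \<open>Smooth matrix functions, from entries to the whole matrix\<close>

lemma matC_on_0_iff: "matC_on 0 t0 F \<longleftrightarrow> continuous_on {t0..} F"
  by (simp add: matC_on_def C_on_def continuous_on_vec_iff)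

lemma matC_on_Suc_iff:
  "matC_on (Suc n) t0 F \<longleftrightarrow>
   (\<exists>F'. (\<forall>t\<ge>t0. (F has_vector_derivative F' t) (at t within {t0..})) \<and> matC_on n t0 F')"
proof
  assume "matC_on (Suc n) t0 F"
  then obtain f' where
    "\<forall>i j. (\<forall>t\<ge>t0. ((\<lambda>t. F t $ i $ j) has_vector_derivative f' i j t) (at t within {t0..})) \<and>
           C_on n t0 (f' i j)"
    unfolding matC_on_def C_on_Suc_iff by metis
  then show "\<exists>F'. (\<forall>t\<ge>t0. (F has_vector_derivative F' t) (at t within {t0..})) \<and> matC_on n t0 F'"
    by (intro exI[of _ "\<lambda>t. \<chi> i j. f' i j t"]) (auto simp: matC_on_def has_vector_derivative_vec_iff)
next
  assume "\<exists>F'. (\<forall>t\<ge>t0. (F has_vector_derivative F' t) (at t within {t0..})) \<and> matC_on n t0 F'"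
  then show "matC_on (Suc n) t0 F"
    unfolding matC_on_def C_on_Suc_iff by (fastforce simp: has_vector_derivative_vec_iff)
qed

lemma nth_deriv_1_eq:
  assumes "\<And>s. s \<ge> t0 \<Longrightarrow> (f has_vector_derivative f' s) (at s within {t0..})" "t \<ge> t0"
  shows "nth_deriv t0 1 f t = f' t"
  using nth_deriv_Suc_eq[OF assms, of 0] by simp

lemma nth_deriv_2_eq:
  assumes "\<And>s. s \<ge> t0 \<Longrightarrow> (f has_vector_derivative f' s) (at s within {t0..})"
    and "\<And>s. s \<ge> t0 \<Longrightarrow> (f' has_vector_derivative f'' s) (at s within {t0..})" "t \<ge> t0"
  shows "nth_deriv t0 2 f t = f'' t"
  using nth_deriv_Suc_eq[OF assms(1,3), of 1] nth_deriv_1_eq[OF assms(2,3)]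
  by (simp add: numeral_2_eq_2)

lemma matC_on_1E:
  assumes "matC_on 1 t0 F"
  obtains F' where "\<And>t. t \<ge> t0 \<Longrightarrow> (F has_vector_derivative F' t) (at t within {t0..})"
    "continuous_on {t0..} F'" "continuous_on {t0..} F"
proof -
  obtain F' where F': "\<And>t. t \<ge> t0 \<Longrightarrow> (F has_vector_derivative F' t) (at t within {t0..})"
    "continuous_on {t0..} F'"
    using assms unfolding One_nat_def matC_on_Suc_iff matC_on_0_iff by blast
  moreover have "continuous_on {t0..} F"
    using F'(1) by (intro continuous_on_vector_derivative[of _ F F']) auto
  ultimately show thesis by (rule that)
qed

lemma matC_on_1I:
  assumes "\<And>t. t \<ge> t0 \<Longrightarrow> (F has_vector_derivative F' t) (at t within {t0..})"
    "continuous_on {t0..} F'"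
  shows "matC_on 1 t0 F"
  using assms unfolding One_nat_def matC_on_Suc_iff matC_on_0_iff by blast

lemma matC_on_2_iff:
  "matC_on 2 t0 F \<longleftrightarrow>
   (\<exists>F' F''. (\<forall>t\<ge>t0. (F has_vector_derivative F' t) (at t within {t0..})) \<and>
     (\<forall>t\<ge>t0. (F' has_vector_derivative F'' t) (at t within {t0..})) \<and> continuous_on {t0..} F'')"
  unfolding numeral_2_eq_2 matC_on_Suc_iff matC_on_0_iff by blast

subsection \<open>Linear differential equations\<close>

text \<open>Picard iteration written as a series: on each compact interval its terms are dominated
  by those of an exponential series, so it converges uniformly and can be differentiated term by
  term. The abstract \<open>prod\<close> lets matrix multiplication be inserted directly.\<close>

lemma linear_ode_solution_exists:
  fixes prod :: "'a::real_normed_vector \<Rightarrow> 'b::banach \<Rightarrow> 'b" and M :: "real \<Rightarrow> 'a"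
  assumes "bounded_bilinear prod" and M: "continuous_on {a..} M"
  obtains x where "x a = x0"
    and "\<And>t. t \<ge> a \<Longrightarrow> (x has_vector_derivative prod (M t) (x t)) (at t within {a..})"
proof -
  interpret bounded_bilinear prod by fact
  \<comment> \<open>\<open>u 0\<close> is the constant start and \<open>u (Suc n)\<close> the
    increment from one Picard iterate to the next, so the partial sums are the iterates.\<close>
  define u where "u = rec_nat (\<lambda>t. x0) (\<lambda>n un t. integral {a..t} (\<lambda>s. prod (M s) (un s)))"
  have u0: "u 0 t = x0" for t by (simp add: u_def)
  have uSuc: "u (Suc n) t = integral {a..t} (\<lambda>s. prod (M s) (u n s))" for n t
    by (simp add: u_def)
  have ua: "u n a = (if n = 0 then x0 else 0)" for n
    by (cases n) (auto simp: u0 uSuc)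
  define u' where "u' n t = (case n of 0 \<Rightarrow> 0 | Suc m \<Rightarrow> prod (M t) (u m t))" for n t
  define x where "x t = (\<Sum>n. u n t)" for t
  \<comment> \<open>One series defines \<open>x\<close> for all \<open>t\<close>, so it suffices to
    work on \<open>{a..b}\<close> with \<open>b\<close> arbitrary, and no local solutions have to be
    glued.\<close>
  have x_deriv: "(x has_vector_derivative prod (M t) (x t)) (at t within {a..b})"
    if "t \<in> {a..b}" for t b
  proof -
    have Mc: "continuous_on {a..b} M" using M by (rule continuous_on_subset) auto
    have du: "continuous_on {a..b} (u n) \<and>
        (\<forall>t\<in>{a..b}. (u n has_vector_derivative u' n t) (at t within {a..b}))" for n
    proof (induction n)
      case 0
      have "u 0 = (\<lambda>t. x0)" using u0 by auto
      then show ?case by (simp add: u'_def)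
    next
      case (Suc n)
      have "u (Suc n) = (\<lambda>t. integral {a..t} (\<lambda>s. prod (M s) (u n s)))" using uSuc by auto
      then have "\<forall>t\<in>{a..b}. (u (Suc n) has_vector_derivative u' (Suc n) t) (at t within {a..b})"
        using Suc Mc by (auto simp: u'_def intro!: integral_has_vector_derivative continuous_on)
      then show ?case by (auto intro: continuous_on_vector_derivative)
    qed
    obtain B where B: "\<And>t. t \<in> {a..b} \<Longrightarrow> norm (M t) \<le> B"
      using compact_imp_bounded[OF compact_continuous_image[OF Mc compact_Icc]]
      unfolding bounded_iff by blast
    obtain K where K: "K \<ge> 0" "\<And>p q. norm (prod p q) \<le> norm p * norm q * K"
      using nonneg_bounded by blast
    define C where "C = B * K"
    have B0: "B \<ge> 0" using B[OF that] norm_ge_zero order_trans by blast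
    have C0: "C \<ge> 0" using K B0 by (simp add: C_def)
    have C: "norm (prod (M t) q) \<le> C * norm q" if "t \<in> {a..b}" for t q
    proof -
      have "norm (M t) * norm q * K \<le> B * norm q * K"
        using B[OF that] K by (intro mult_right_mono) auto
      then show ?thesis using K(2)[of "M t" q] by (simp add: C_def mult_ac)
    qed
    \<comment> \<open>In the induction step \<open>u (Suc n)\<close> and the majorant are compared
      through their derivatives by the mean value inequality. This needs \<open>a < t\<close>; at
      \<open>t = a\<close> the term vanishes.\<close>
    have bound: "norm (u n t) \<le> norm x0 * ((C * (t - a)) ^ n / fact n)" if "t \<in> {a..b}" for n t
      using that
    proof (induction n arbitrary: t)
      case 0
      then show ?case by (simp add: u0)
    next
      case (Suc n)
      show ?case
      proof (cases "t = a")
        case True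
        then show ?thesis by (simp add: ua)
      next
        case False
        then have at: "a < t" using Suc.prems by auto
        let ?phi = "\<lambda>t. norm x0 * ((C * (t - a)) ^ Suc n / fact (Suc n))"
        let ?phi' = "\<lambda>t. norm x0 * (C * (C * (t - a)) ^ n / fact n)"
        have "norm (u (Suc n) t - u (Suc n) a) \<le> ?phi t - ?phi a"
        proof (rule differentiable_bound_general[OF at, where f' = "u' (Suc n)" and \<phi>' = ?phi'])
          show "continuous_on {a..t} (u (Suc n))"
            using du[of "Suc n"] Suc.prems by (auto elim: continuous_on_subset)
          show "continuous_on {a..t} ?phi" by (intro continuous_intros) auto
          fix s assume s: "a < s" "s < t"
          then have s': "s \<in> {a..b}" using Suc.prems by auto
          show "(u (Suc n) has_vector_derivative u' (Suc n) s) (at s)"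
            using bspec[OF conjunct2[OF du[of "Suc n"]] s'] s Suc.prems at_within_Icc_at[of a s b]
            by simp
          have "(?phi has_real_derivative
              norm x0 * (real (Suc n) * (C * (C * (s - a)) ^ n) / fact (Suc n))) (at s)"
            by (rule derivative_eq_intros refl | simp)+
          then show "(?phi has_vector_derivative ?phi' s) (at s)"
            by (simp add: has_real_derivative_iff_has_vector_derivative[symmetric] mult.assoc
                del: of_nat_Suc)
          show "norm (u' (Suc n) s) \<le> ?phi' s"
            using C[OF s', of "u n s"] mult_left_mono[OF Suc.IH[OF s'] C0]
            by (simp add: u'_def mult_ac)
        qed
        then show ?thesis by (simp add: ua)
      qed
    qed
    let ?c = "C * (b - a)"
    have bound': "norm (u n t) \<le> norm x0 * (?c ^ n / fact n)" if "t \<in> {a..b}" for n t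
    proof -
      have "(C * (t - a)) ^ n \<le> ?c ^ n"
        using that C0 by (intro power_mono mult_left_mono) auto
      then show ?thesis
        using bound[OF that, of n]
        by (meson divide_right_mono fact_ge_zero mult_left_mono norm_ge_zero order_trans)
    qed
    have "summable (\<lambda>n. norm x0 * (?c ^ n / fact n))"
      using summable_exp[of ?c] by (intro summable_mult) (simp add: divide_inverse_commute)
    then have sm: "summable (\<lambda>n. u n t)"
        and ul: "uniform_limit {a..b} (\<lambda>n t. \<Sum>i<n. u i t) x sequentially" if "t \<in> {a..b}" for t
      using Weierstrass_m_test[of "{a..b}" u "\<lambda>n. norm x0 * (?c ^ n / fact n)"] bound' that
      unfolding x_def by (auto intro: summable_comparison_test')
    have "\<exists>g. \<forall>t\<in>{a..b}. (\<lambda>n. u n t) sums (g t) \<and>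
        (g has_derivative (\<lambda>h. h *\<^sub>R prod (M t) (x t))) (at t within {a..b})"
    proof (rule has_derivative_series)
      show "(u n has_derivative (\<lambda>h. h *\<^sub>R u' n t)) (at t within {a..b})" if "t \<in> {a..b}" for n t
        using du[of n] that by (auto simp: has_vector_derivative_def)
      show "(\<lambda>n. u n t) sums (\<Sum>n. u n t)" using sm that by blast
      \<comment> \<open>The partial sums are taken within \<open>e / (C + 1)\<close> of
        \<open>x\<close>; the summand 1 keeps the divisor positive when
        \<open>C = 0\<close>.\<close>
      fix e :: real assume e: "e > 0"
      have "\<forall>\<^sub>F n in sequentially. \<forall>t\<in>{a..b}. dist (\<Sum>i<n. u i t) (x t) < e / (C + 1)"
        using uniform_limitD[OF ul[OF that], of "e / (C + 1)"] e C0 by simp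
      then have "\<forall>\<^sub>F n in sequentially. \<forall>t\<in>{a..b}. \<forall>h.
          norm ((\<Sum>i<Suc n. h *\<^sub>R u' i t) - h *\<^sub>R prod (M t) (x t)) \<le> e * norm h"
      proof (rule eventually_mono, safe)
        fix n t and h :: real
        assume n: "\<forall>t\<in>{a..b}. dist (\<Sum>i<n. u i t) (x t) < e / (C + 1)" and t: "t \<in> {a..b}"
        \<comment> \<open>As \<open>u' 0 = 0\<close>, the first \<open>n + 1\<close> derivative
          terms correspond to \<open>n\<close> terms of the series for \<open>x\<close>;
          \<open>eventually_sequentially_Suc\<close> absorbs the shift afterwards.\<close>
        have "(\<Sum>i<Suc n. u' i t) = prod (M t) (\<Sum>i<n. u i t)"
          unfolding sum.lessThan_Suc_shift by (simp add: u'_def sum_right)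
        then have "(\<Sum>i<Suc n. h *\<^sub>R u' i t) - h *\<^sub>R prod (M t) (x t) =
            h *\<^sub>R prod (M t) ((\<Sum>i<n. u i t) - x t)"
          by (simp only: scaleR_sum_right[symmetric] diff_right scaleR_diff_right)
        moreover have "norm (prod (M t) ((\<Sum>i<n. u i t) - x t)) \<le> C * (e / (C + 1))"
          using n t C0 by (intro order_trans[OF C[OF t]] mult_left_mono) (auto simp: dist_norm less_imp_le)
        moreover have "C * (e / (C + 1)) \<le> e" using C0 e by (simp add: field_simps)
        ultimately show "norm ((\<Sum>i<Suc n. h *\<^sub>R u' i t) - h *\<^sub>R prod (M t) (x t)) \<le> e * norm h"
          by (simp add: mult.commute[of e] mult_left_mono)
      qed
      then show "\<forall>\<^sub>F n in sequentially. \<forall>t\<in>{a..b}. \<forall>h.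
          norm ((\<Sum>i<n. h *\<^sub>R u' i t) - h *\<^sub>R prod (M t) (x t)) \<le> e * norm h"
        by (subst eventually_sequentially_Suc[symmetric]) (auto elim: eventually_mono)
    qed (use that in auto)
    then obtain g where g: "\<forall>t\<in>{a..b}. (\<lambda>n. u n t) sums (g t) \<and>
        (g has_derivative (\<lambda>h. h *\<^sub>R prod (M t) (x t))) (at t within {a..b})" by blast
    then have "\<forall>t\<in>{a..b}. x t = g t" unfolding x_def by (auto simp: sums_iff)
    then show ?thesis
      using g that by (auto simp: has_vector_derivative_def intro: has_derivative_transform)
  qed
  show thesis
  proof
    show "x a = x0" unfolding x_def ua using sums_unique[OF sums_single[of 0 "\<lambda>_. x0"]] by simp
    fix t assume "t \<ge> a"
    then show "(x has_vector_derivative prod (M t) (x t)) (at t within {a..})"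
      using x_deriv[of t "t + 1"] by (simp add: at_within_atLeastAtMost)
  qed
qed

subsection \<open>Matrix-valued functions\<close>

text \<open>Bilinear maps between finite-dimensional spaces are bounded; this yields the product
  rule, limits and continuity for matrix products.\<close>

interpretation matrix_mult: bounded_bilinear "(**) :: real^'n^'m \<Rightarrow> real^'k^'n \<Rightarrow> real^'k^'m"
  unfolding bilinear_conv_bounded_bilinear[symmetric] bilinear_def
  by (intro conjI allI linearI)
    (simp_all add: matrix_matrix_mult_def vec_eq_iff sum.distrib algebra_simps sum_distrib_left)

lemma transpose_add: "transpose (A + B) = transpose A + transpose (B :: 'a::plus^'n^'m)"
  by (simp add: transpose_def vec_eq_iff)

lemma transpose_minus: "transpose (- A) = - transpose (A :: 'a::uminus^'n^'m)"
  by (simp add: transpose_def vec_eq_iff)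

lemma transpose_diff: "transpose (A - B) = transpose A - transpose (B :: 'a::minus^'n^'m)"
  by (simp add: transpose_def vec_eq_iff)

lemmas transpose_simps = transpose_add transpose_minus transpose_diff transpose_scalar
  matrix_transpose_mul transpose_transpose

lemma bounded_linear_transpose: "bounded_linear (transpose :: real^'n^'m \<Rightarrow> real^'m^'n)"
  unfolding linear_conv_bounded_linear[symmetric]
  by (rule linearI) (simp_all add: transpose_simps)

lemma bounded_linear_trace: "bounded_linear (trace :: real^'n^'n \<Rightarrow> real)"
  unfolding linear_conv_bounded_linear[symmetric]
  by (rule linearI) (simp_all add: trace_def sum.distrib sum_distrib_left)

lemmas has_vector_derivative_transpose = bounded_linear.has_vector_derivative[OF bounded_linear_transpose]
lemmas continuous_on_transpose = bounded_linear.continuous_on[OF bounded_linear_transpose]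

lemmas matrix_mult_simps = matrix_mult.add_left matrix_mult.add_right
  matrix_mult.diff_left matrix_mult.diff_right matrix_mult.minus_left matrix_mult.minus_right
  matrix_mult.scaleR_left matrix_mult.scaleR_right

section \<open>Inverse matrices: continuity, boundedness, derivative\<close>

lemma matrix_inv_mult:
  fixes M :: "real^'n^'n"
  assumes "det M \<noteq> 0"
  shows matrix_inv_mult_right: "M ** matrix_inv M = mat 1"
    and matrix_inv_mult_left: "matrix_inv M ** M = mat 1"
  using assms unfolding invertible_det_nz[symmetric] invertible_def matrix_inv_def
  by (auto dest!: someI_ex)

lemma matrix_inv_unique:
  fixes M :: "real^'n^'n"
  assumes "M ** N = mat 1"
  shows "matrix_inv M = N"
proof -
  have "det M \<noteq> 0"
    using assms by (metis det_I det_mul mult_zero_left zero_neq_one)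
  then show ?thesis
    by (metis assms matrix_inv_mult_left matrix_mul_assoc matrix_mul_lid matrix_mul_rid)
qed

lemma transpose_matrix_inv:
  fixes M :: "real^'n^'n"
  assumes "det M \<noteq> 0"
  shows "transpose (matrix_inv M) = matrix_inv (transpose M)"
  using assms
  by (intro matrix_inv_unique[symmetric])
    (simp add: matrix_transpose_mul[symmetric] matrix_inv_mult_left)

text \<open>Cramer's rule, applied to the columns of the inverse, reduces continuity of inversion to
  continuity of determinants.\<close>

lemma matrix_inv_nth_cramer:
  fixes M :: "real^'n^'n"
  assumes "det M \<noteq> 0"
  shows "matrix_inv M $ k $ l = det (\<chi> i j. if j = k then axis l 1 $ i else M $ i $ j) / det M"
proof -
  have "M *v (matrix_inv M *v axis l 1) = axis l 1"
    by (simp add: matrix_vector_mul_assoc matrix_inv_mult_right[OF assms])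
  then have "matrix_inv M *v axis l 1 =
      (\<chi> k. det (\<chi> i j. if j = k then axis l 1 $ i else M $ i $ j) / det M)"
    by (simp only: cramer[OF assms])
  then show ?thesis by (simp add: matrix_vector_mult_basis column_def vec_eq_iff)
qed

lemma continuous_on_det:
  fixes F :: "'a::topological_space \<Rightarrow> real^'n^'n"
  assumes "continuous_on T F"
  shows "continuous_on T (\<lambda>t. det (F t))"
  using assms unfolding det_def by (intro continuous_intros)

lemma continuous_on_matrix_inv:
  fixes F :: "'a::topological_space \<Rightarrow> real^'n^'n"
  assumes F: "continuous_on T F" and nz: "\<And>t. t \<in> T \<Longrightarrow> det (F t) \<noteq> 0"
  shows "continuous_on T (\<lambda>t. matrix_inv (F t))"
proof -
  have "continuous_on T (\<lambda>t. det (\<chi> i j. if j = k then axis l 1 $ i else F t $ i $ j) / det (F t))"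
    for k l
  proof (intro continuous_on_divide continuous_on_det F continuous_on_vec_lambda)
    show "continuous_on T (\<lambda>t. if j = k then axis l 1 $ i else F t $ i $ j)" for i j
      by (cases "j = k") (auto intro!: continuous_intros F)
  qed (use nz in auto)
  then show ?thesis
    unfolding continuous_on_vec_iff[of _ "\<lambda>t. matrix_inv (F t)"]
      continuous_on_vec_iff[of _ "\<lambda>t. matrix_inv (F t) $ _"]
    by (simp add: nz matrix_inv_nth_cramer cong: continuous_on_cong)
qed

text \<open>The closure of the range of \<open>F\<close>, cut down to matrices with
  \<open>\<bar>det M\<bar> \<ge> c\<close>, is compact, and inversion is continuous on it.\<close>

lemma bounded_matrix_inv:
  fixes F :: "'a \<Rightarrow> real^'n^'n"
  assumes "bounded (F ` T)" and "c > 0" and det: "\<And>t. t \<in> T \<Longrightarrow> c \<le> \<bar>det (F t)\<bar>"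
  shows "bounded ((\<lambda>t. matrix_inv (F t)) ` T)"
proof -
  let ?C = "closure (F ` T) \<inter> {M. c \<le> \<bar>det M\<bar>}"
  have "closed {M :: real^'n^'n. c \<le> \<bar>det M\<bar>}"
    by (intro closed_Collect_le continuous_intros continuous_on_det)
  then have "compact ?C"
    using assms(1) by (intro compact_Int_closed) (simp add: compact_closure)
  moreover have "continuous_on ?C matrix_inv"
    using \<open>c > 0\<close> by (intro continuous_on_matrix_inv) auto
  ultimately have "bounded (matrix_inv ` ?C)"
    by (intro compact_imp_bounded compact_continuous_image)
  moreover have "F ` T \<subseteq> ?C"
    using det closure_subset[of "F ` T"] by auto
  ultimately show ?thesis
    unfolding image_image[symmetric, of matrix_inv F T] by (meson bounded_subset image_mono)
qed

text \<open>With \<open>G\<close> the inverse of \<open>F\<close>, the identity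
  \<open>G y - G x = - G y (F y - F x) G x\<close> expresses the difference quotient of
  \<open>G\<close> through that of \<open>F\<close>; continuity of \<open>G\<close> then gives the
  limit.\<close>

lemma has_vector_derivative_matrix_inv:
  fixes F :: "real \<Rightarrow> real^'n^'n"
  assumes F: "(F has_vector_derivative F') (at x within T)" and x: "x \<in> T"
    and nz: "\<And>t. t \<in> T \<Longrightarrow> det (F t) \<noteq> 0" and cont: "continuous_on T F"
  shows "((\<lambda>t. matrix_inv (F t)) has_vector_derivative
    - (matrix_inv (F x) ** F' ** matrix_inv (F x))) (at x within T)"
proof -
  let ?G = "\<lambda>t. matrix_inv (F t)"
  have "((\<lambda>y. - (?G y ** ((F y - F x) /\<^sub>R (y - x)) ** ?G x)) \<longlongrightarrow> - (?G x ** F' ** ?G x)) (at x within T)"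
    using F continuous_on_matrix_inv[OF cont nz] x
    unfolding has_vector_derivative_iff_tendsto_quotient continuous_on_def
    by (intro tendsto_minus matrix_mult.tendsto tendsto_const) auto
  moreover have "(?G y - ?G x) /\<^sub>R (y - x) = - (?G y ** ((F y - F x) /\<^sub>R (y - x)) ** ?G x)"
    if "y \<in> T" for y
  proof -
    have "?G y ** (F y - F x) ** ?G x = ?G x - ?G y"
      using nz[OF that] nz[OF x]
      by (simp add: matrix_mult.diff_left matrix_mult.diff_right matrix_inv_mult
          flip: matrix_mul_assoc)
    then show ?thesis
      by (simp only: matrix_mult.scaleR_left matrix_mult.scaleR_right) (simp add: scaleR_diff_right)
  qed
  then have "\<forall>\<^sub>F y in at x within T.
      - (?G y ** ((F y - F x) /\<^sub>R (y - x)) ** ?G x) = (?G y - ?G x) /\<^sub>R (y - x)"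
    by (auto simp: eventually_at_filter)
  ultimately show ?thesis
    unfolding has_vector_derivative_iff_tendsto_quotient by (rule Lim_transform_eventually)
qed

section \<open>Trace, determinant and boundedness of matrix products\<close>

lemma trace_mult_transpose: "trace (L ** transpose L) = (norm (L :: real^'n^'m))\<^sup>2"
  by (simp add: power2_norm_eq_inner inner_vec_def trace_def matrix_matrix_mult_def transpose_def)

lemma det_mult_transpose: "det (L ** transpose L) = (det (L :: real^'n^'n))\<^sup>2"
  by (simp add: det_mul power2_eq_square)

lemma bdd_above_norm_iff: "bdd_above ((\<lambda>t. norm (f t)) ` T) \<longleftrightarrow> bounded (f ` T)"
  by (auto simp: bdd_above_def bounded_iff)

lemma bounded_matrix_mult:
  fixes f :: "'a \<Rightarrow> real^'n^'m" and g :: "'a \<Rightarrow> real^'k^'n"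
  assumes "bounded (f ` T)" "bounded (g ` T)"
  shows "bounded ((\<lambda>t. f t ** g t) ` T)"
proof -
  obtain b c where b: "\<And>t. t \<in> T \<Longrightarrow> norm (f t) \<le> b" and c: "\<And>t. t \<in> T \<Longrightarrow> norm (g t) \<le> c"
    using assms by (auto simp: bounded_iff)
  obtain K where K: "K \<ge> 0" "\<And>(p :: real^'n^'m) (q :: real^'k^'n). norm (p ** q) \<le> norm p * norm q * K"
    using matrix_mult.nonneg_bounded by blast
  have "norm (f t ** g t) \<le> b * c * K" if "t \<in> T" for t
  proof -
    have "norm (f t) * norm (g t) * K \<le> b * c * K"
      using b[OF that] c[OF that] K(1) order_trans[OF norm_ge_zero b[OF that]]
      by (intro mult_right_mono mult_mono) auto
    with K(2) show ?thesis by (rule order_trans)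
  qed
  then show ?thesis by (auto simp: bounded_iff)
qed

lemma bounded_transpose:
  fixes f :: "'a \<Rightarrow> real^'n^'m"
  shows "bounded (f ` T) \<Longrightarrow> bounded ((\<lambda>t. transpose (f t)) ` T)"
  using bounded_linear_image[OF _ bounded_linear_transpose, of "f ` T"] by (simp add: image_image)

lemma bounded_scaleR_const:
  fixes f :: "'a \<Rightarrow> 'b::real_normed_vector"
  shows
  "bounded (f ` T) \<Longrightarrow> bounded ((\<lambda>t. c *\<^sub>R f t) ` T)"
  using bounded_scaling[of "f ` T" c] by (simp add: image_image)

lemma bounded_minus_image: "bounded (f ` T) \<Longrightarrow> bounded ((\<lambda>t. - f t) ` T)"
  for f :: "'a \<Rightarrow> 'b::real_normed_vector"
  by (auto simp: bounded_iff)

lemmas bounded_matrix_intros = bounded_matrix_mult bounded_transpose bounded_scaleR_const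
  bounded_plus_comp bounded_minus_comp bounded_minus_image

subsection \<open>Factorisation along a path of symmetric matrices\<close>

text \<open>If \<open>L L\<^sup>T = \<Lambda>\<close>, the inverse of \<open>L\<^sup>T\<close> is
  \<open>\<Lambda>\<^sup>-\<^sup>1 L\<close>, so prescribing \<open>L' L\<^sup>T = S + K\<close> is
  the same as this linear equation. It is used twice: with \<open>K = 0\<close> to factor
  \<open>S0\<close>, and with the \<open>K\<close> built from \<open>A\<close>.\<close>

lemma matrix_ode_factor_exists:
  fixes \<Lambda> S K :: "real \<Rightarrow> real^'m^'m" and L0 :: "real^'m^'m"
  assumes \<Lambda>': "\<And>t. t \<ge> a \<Longrightarrow> (\<Lambda> has_vector_derivative 2 *\<^sub>R S t) (at t within {a..})"
    and cont: "continuous_on {a..} S" "continuous_on {a..} K"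
    and sym\<Lambda>: "\<And>t. t \<ge> a \<Longrightarrow> transpose (\<Lambda> t) = \<Lambda> t"
    and symS: "\<And>t. t \<ge> a \<Longrightarrow> transpose (S t) = S t"
    and antiK: "\<And>t. t \<ge> a \<Longrightarrow> transpose (K t) = - K t"
    and nz: "\<And>t. t \<ge> a \<Longrightarrow> det (\<Lambda> t) \<noteq> 0"
    and L0: "L0 ** transpose L0 = \<Lambda> a"
  obtains L :: "real \<Rightarrow> real^'m^'m" where "L a = L0"
    and "\<And>t. t \<ge> a \<Longrightarrow> (L has_vector_derivative (S t + K t) ** matrix_inv (\<Lambda> t) ** L t) (at t within {a..})"
    and "\<And>t. t \<ge> a \<Longrightarrow> L t ** transpose (L t) = \<Lambda> t"
proof -
  let ?I = "\<lambda>t. matrix_inv (\<Lambda> t)"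
  have cont\<Lambda>: "continuous_on {a..} \<Lambda>"
    using \<Lambda>' by (intro continuous_on_vector_derivative[where f' = "\<lambda>t. 2 *\<^sub>R S t"]) auto
  have "continuous_on {a..} (\<lambda>t. (S t + K t) ** ?I t)"
    using nz by (intro matrix_mult.continuous_on continuous_on_add cont continuous_on_matrix_inv cont\<Lambda>) auto
  then obtain L where La: "L a = L0" and
    L': "\<And>t. t \<ge> a \<Longrightarrow> (L has_vector_derivative (S t + K t) ** ?I t ** L t) (at t within {a..})"
    using linear_ode_solution_exists[OF matrix_mult.bounded_bilinear_axioms, of a "\<lambda>t. (S t + K t) ** ?I t" L0]
    by blast
  \<comment> \<open>\<open>X\<close> is a first integral; its constant value \<open>I\<close> is equivalent to \<open>L L\<^sup>T = \<Lambda>\<close>.\<close>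
  define X where "X t = transpose (L t) ** ?I t ** L t" for t
  have "(X has_vector_derivative 0) (at t within {a..})" if t: "t \<ge> a" for t
  proof -
    have symI: "transpose (?I t) = ?I t"
      using t by (simp add: transpose_matrix_inv nz sym\<Lambda>)
    have "(?I has_vector_derivative - (?I t ** (2 *\<^sub>R S t) ** ?I t)) (at t within {a..})"
      using t by (intro has_vector_derivative_matrix_inv \<Lambda>' nz cont\<Lambda>) auto
    \<comment> \<open>Since \<open>S\<close> is symmetric and \<open>K\<close> antisymmetric, the
      three terms add up to \<open>L\<^sup>T \<Lambda>\<^sup>-\<^sup>1 ((S - K) - 2 S + (S + K))
      \<Lambda>\<^sup>-\<^sup>1 L = 0\<close>.\<close>
    from matrix_mult.has_vector_derivative[OF matrix_mult.has_vector_derivative[OF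
          has_vector_derivative_transpose[OF L'[OF t]] this] L'[OF t]]
    show ?thesis
      unfolding X_def
      by (rule has_vector_derivative_eq_rhs)
        (simp only: transpose_simps symI symS[OF t] antiK[OF t] matrix_mul_assoc
          matrix_mult.add_left matrix_mult.add_right matrix_mult.minus_left matrix_mult.minus_right
          matrix_mult.scaleR_left matrix_mult.scaleR_right, simp add: scaleR_2)
  qed
  then obtain C where C: "\<And>t. t \<in> {a..} \<Longrightarrow> X t = C"
    using has_vector_derivative_zero_constant[of "{a..}" X thesis] by simp
  \<comment> \<open>For square matrices a right inverse is a left inverse. Used at \<open>a\<close>
    this gives \<open>X a = I\<close>; used again at \<open>t\<close> it turns
    \<open>X t = I\<close> back into a statement about \<open>L L\<^sup>T\<close>.\<close>
  have inv0: "L0 ** (transpose L0 ** ?I a) = mat 1"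
    using matrix_inv_mult_right[OF nz[of a]] by (simp add: matrix_mul_assoc L0)
  have "X t = mat 1" if "t \<ge> a" for t
    using iffD1[OF matrix_left_right_inverse inv0] C[of t] C[of a] that by (simp add: X_def La)
  then have inv: "L t ** (transpose (L t) ** ?I t) = mat 1" if "t \<ge> a" for t
    using iffD1[OF matrix_left_right_inverse] that unfolding X_def by blast
  have "L t ** transpose (L t) = \<Lambda> t" if "t \<ge> a" for t
  proof -
    have "L t ** transpose (L t) = L t ** (transpose (L t) ** ?I t) ** \<Lambda> t"
      using matrix_inv_mult_left[OF nz[OF that]] by (simp flip: matrix_mul_assoc)
    then show ?thesis using inv[OF that] by simp
  qed
  with that La L' show thesis by blast
qed

text \<open>A factorisation of \<open>S0\<close> is obtained by solving the same equation along the path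
  \<open>(1 - s)\<^sup>2 I + s S0\<close> of positive definite matrices from \<open>I\<close> (at \<open>s = 0\<close>) to \<open>S0\<close> (at \<open>s = 1\<close>).\<close>

lemma symmetric_positive_definite_factor:
  fixes S0 :: "real^'m^'m"
  assumes sym: "symmetric_matrix S0" and pd: "positive_definite_matrix S0"
  obtains L0 :: "real^'m^'m" where "L0 ** transpose L0 = S0"
proof -
  \<comment> \<open>The equation is solved on all of \<open>{0..}\<close>. The square keeps the path
    positive definite beyond \<open>s = 1\<close>, where a factor \<open>1 - s\<close> would turn
    negative. \<open>S\<close> is half the derivative of the path.\<close>
  define \<Lambda> where "\<Lambda> s = (1 - s)\<^sup>2 *\<^sub>R mat 1 + s *\<^sub>R S0" for s
  define S where "S s = (s - 1) *\<^sub>R mat 1 + (1 / 2) *\<^sub>R S0" for s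
  have nz: "det (\<Lambda> s) \<noteq> 0" if s: "s \<ge> 0" for s
  proof -
    have "x = 0" if "\<Lambda> s *v x = 0" for x
    proof (rule ccontr)
      assume x: "x \<noteq> 0"
      have "\<Lambda> s *v x = (1 - s)\<^sup>2 *\<^sub>R x + s *\<^sub>R (S0 *v x)"
        unfolding \<Lambda>_def matrix_vector_mult_add_rdistrib
        by (simp only: scaleR_matrix_vector_assoc[symmetric] matrix_vector_mul_lid)
      then have "x \<bullet> (\<Lambda> s *v x) = (1 - s)\<^sup>2 * (x \<bullet> x) + s * (x \<bullet> (S0 *v x))"
        by (simp add: inner_add_right)
      moreover have "x \<bullet> (S0 *v x) > 0" "x \<bullet> x > 0"
        using pd x by (auto simp: positive_definite_matrix_def)
      ultimately have "x \<bullet> (\<Lambda> s *v x) > 0"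
        using s by (cases "s = 0") (simp_all add: add_nonneg_pos)
      then show False using that by simp
    qed
    then have "\<exists>B. B ** \<Lambda> s = mat 1"
      unfolding matrix_left_invertible_ker by blast
    then show ?thesis
      by (simp add: invertible_left_inverse flip: invertible_det_nz)
  qed
  have \<Lambda>': "(\<Lambda> has_vector_derivative 2 *\<^sub>R S s) (at s within {0..})" for s
  proof -
    have "((\<lambda>s. (1 - s)\<^sup>2) has_real_derivative 2 * (s - 1)) (at s within {0..})"
      by (rule derivative_eq_intros refl | simp)+
    then have "(\<Lambda> has_vector_derivative ((1 - s)\<^sup>2 *\<^sub>R 0 + (2 * (s - 1)) *\<^sub>R mat 1) +
        (s *\<^sub>R 0 + 1 *\<^sub>R S0)) (at s within {0..})"
      unfolding \<Lambda>_def
      by (intro has_vector_derivative_add has_vector_derivative_scaleR has_vector_derivative_const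
          DERIV_ident)
    then show ?thesis by (simp add: S_def scaleR_add_right)
  qed
  have cont: "continuous_on {0..} S"
    unfolding S_def by (intro continuous_intros)
  have sym': "transpose (\<Lambda> s) = \<Lambda> s" "transpose (S s) = S s" for s
    using sym by (simp_all add: \<Lambda>_def S_def transpose_simps symmetric_matrix_def)
  have anti: "transpose (0 :: real^'m^'m) = - 0"
    by (simp add: transpose_def vec_eq_iff)
  show thesis
  proof (rule matrix_ode_factor_exists[of 0 \<Lambda> S "\<lambda>_. 0" "mat 1"])
    fix L :: "real \<Rightarrow> real^'m^'m"
    assume "\<And>s. s \<ge> 0 \<Longrightarrow> L s ** transpose (L s) = \<Lambda> s"
    from this[of 1] show thesis by (intro that[of "L 1"]) (simp add: \<Lambda>_def)
  next
    show "mat 1 ** transpose (mat 1) = \<Lambda> 0" by (simp add: \<Lambda>_def)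
  qed (intro \<Lambda>' cont continuous_on_const sym' anti nz; assumption)+
qed

section \<open>Derivative, trace and symmetry of \<open>Lambda_mat\<close>\<close>

lemma Lambda_mat_has_vector_derivative:
  fixes S :: "real \<Rightarrow> real^'m^'m"
  assumes "continuous_on {t0..} S" "t \<ge> t0"
  shows "(Lambda_mat t0 S S0 has_vector_derivative 2 *\<^sub>R S t) (at t within {t0..})"
proof -
  have "continuous_on {t0..t + 1} S" using assms(1) by (rule continuous_on_subset) auto
  then have "((\<lambda>u. integral {t0..u} S) has_vector_derivative S t) (at t within {t0..t + 1})"
    using assms(2) by (intro integral_has_vector_derivative) auto
  then show ?thesis
    unfolding Lambda_mat_def at_within_atLeastAtMost[OF assms(2)] by (auto intro!: derivative_eq_intros)
qed

lemma trace_Lambda_mat: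
  fixes S :: "real \<Rightarrow> real^'m^'m"
  assumes "continuous_on {t0..} S"
  shows "2 * integral {t0..t} (\<lambda>\<nu>. trace (S \<nu>)) + trace S0 = trace (Lambda_mat t0 S S0 t)"
proof -
  have "S integrable_on {t0..t}"
    using assms by (intro integrable_continuous_real) (auto elim: continuous_on_subset)
  from integral_linear[OF this bounded_linear_trace] show ?thesis
    by (simp add: o_def Lambda_mat_def linear_add linear_scale bounded_linear_trace bounded_linear.linear)
qed

lemma transpose_Lambda_mat:
  fixes S :: "real \<Rightarrow> real^'m^'m"
  assumes "continuous_on {t0..} S" and sym: "\<And>t. t \<ge> t0 \<Longrightarrow> transpose (S t) = S t" "transpose S0 = S0"
  shows "transpose (Lambda_mat t0 S S0 t) = Lambda_mat t0 S S0 t"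
proof -
  have "S integrable_on {t0..t}"
    using assms(1) by (intro integrable_continuous_real) (auto elim: continuous_on_subset)
  from integral_linear[OF this bounded_linear_transpose]
  have "transpose (integral {t0..t} S) = integral {t0..t} (\<lambda>s. transpose (S s))"
    by (simp add: o_def)
  also have "\<dots> = integral {t0..t} S"
    using sym by (intro integral_cong) auto
  finally show ?thesis by (simp add: Lambda_mat_def transpose_simps sym)
qed

subsection \<open>Reduction to symmetric form\<close>

text \<open>The integrand is half the derivative of \<open>L L\<^sup>T\<close>, and the constant
  term is its value at \<open>t0\<close>, so the fundamental theorem of calculus recovers the
  product.\<close>

lemma Lambda_mat_eq_mult_transpose:
  fixes L L' :: "real \<Rightarrow> real^'m^'m"
  assumes L': "\<And>t. t \<ge> t0 \<Longrightarrow> (L has_vector_derivative L' t) (at t within {t0..})"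
    and "t \<ge> t0"
  shows "Lambda_mat t0 (\<lambda>t. (1/2) *\<^sub>R (L' t ** transpose (L t) + L t ** transpose (L' t)))
      (L t0 ** transpose (L t0)) t = L t ** transpose (L t)"
proof -
  have "((\<lambda>t. L' t ** transpose (L t) + L t ** transpose (L' t)) has_integral
      L t ** transpose (L t) - L t0 ** transpose (L t0)) {t0..t}"
  proof (rule fundamental_theorem_of_calculus[OF \<open>t \<ge> t0\<close>])
    fix s assume s: "s \<in> {t0..t}"
    then have d: "(L has_vector_derivative L' s) (at s within {t0..t})"
      by (intro has_vector_derivative_within_subset[OF L']) auto
    show "((\<lambda>t. L t ** transpose (L t)) has_vector_derivative
        L' s ** transpose (L s) + L s ** transpose (L' s)) (at s within {t0..t})"
      using matrix_mult.has_vector_derivative[OF d has_vector_derivative_transpose[OF d]]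
      by (simp add: add.commute)
  qed
  from integral_unique[OF has_integral_cmul[OF this, of "1/2"]] show ?thesis
    by (simp only: Lambda_mat_def) simp
qed

text \<open>Necessity. \<open>S\<close> and \<open>K\<close> are the symmetric and antisymmetric
  parts of \<open>L' L\<^sup>T\<close>; this product already contains one derivative of
  \<open>L\<close>, which is why bounds up to order \<open>k\<close> on \<open>L\<close> give bounds
  up to order \<open>k - 1\<close> on \<open>S\<close> and \<open>K\<close>.\<close>

lemma symmetric_Lk_equivalent_imp_conditions:
  fixes A B V W :: "real \<Rightarrow> real^'m^'m"
  assumes k: "k \<in> {0, 1, 2}"
    and V: "\<forall>t\<ge>t0. symmetric_matrix (V t)"
    and equiv: "Lk_equivalent k t0 A B V W"
  obtains S S0 where "matC_on 1 t0 S" "\<forall>t\<ge>t0. symmetric_matrix (S t)"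
    "symmetric_matrix S0" "positive_definite_matrix S0"
    "\<exists>\<mu>>0. \<exists>\<eta>>0. \<forall>t\<ge>t0.
      \<bar>trace (Lambda_mat t0 S S0 t)\<bar> \<le> \<mu>\<^sup>2 \<and> det (Lambda_mat t0 S S0 t) \<ge> \<eta>\<^sup>2"
    "\<forall>i<k. bounded (nth_deriv t0 i (K_mat t0 A S S0) ` {t0..}) \<and> bounded (nth_deriv t0 i S ` {t0..})"
proof -
  obtain L where L: "Lk_matrix k t0 L"
    and VL: "\<And>t. t \<ge> t0 \<Longrightarrow> V t = matrix_inv (L t) ** (2 *\<^sub>R nth_deriv t0 1 L t + A t ** L t)"
    using equiv unfolding Lk_equivalent_def by blast
  obtain L' L'' where
    L': "\<And>t. t \<ge> t0 \<Longrightarrow> (L has_vector_derivative L' t) (at t within {t0..})" and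
    L'': "\<And>t. t \<ge> t0 \<Longrightarrow> (L' has_vector_derivative L'' t) (at t within {t0..})" and
    contL'': "continuous_on {t0..} L''"
    using L unfolding Lk_matrix_def matC_on_2_iff by blast
  have contL: "continuous_on {t0..} L" "continuous_on {t0..} L'"
    using L' L'' by (auto intro: continuous_on_vector_derivative[of _ L L'] continuous_on_vector_derivative[of _ L' L''])
  obtain \<eta> where \<eta>: "\<eta> > 0" "\<And>t. t \<ge> t0 \<Longrightarrow> \<bar>det (L t)\<bar> > \<eta>"
    using L unfolding Lk_matrix_def by blast
  have bdd: "bounded (nth_deriv t0 i L ` {t0..})" if "i \<le> k" for i
    using L that unfolding Lk_matrix_def bdd_above_norm_iff by auto
  have bL: "bounded (L ` {t0..})" using bdd[of 0] by simp
  have bL': "bounded (L' ` {t0..})" if "k \<ge> 1"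
    using bdd[OF that] nth_deriv_1_eq[OF L'] by (simp cong: image_cong_simp)
  have bL'': "bounded (L'' ` {t0..})" if "k \<ge> 2"
    using bdd[OF that] nth_deriv_2_eq[OF L' L''] by (simp cong: image_cong_simp)
  have invR: "L t ** matrix_inv (L t) = mat 1" if "t \<ge> t0" for t
    using \<eta>(1) \<eta>(2)[OF that] by (intro matrix_inv_mult_right) auto
  define S where "S t = (1/2) *\<^sub>R (L' t ** transpose (L t) + L t ** transpose (L' t))" for t
  define S0 where "S0 = L t0 ** transpose (L t0)"
  \<comment> \<open>\<open>D\<close> is the derivative of \<open>L' L\<^sup>T\<close>, so
    \<open>S\<close> and \<open>K\<close> have derivatives \<open>(D + D\<^sup>T) / 2\<close> and
    \<open>(D - D\<^sup>T) / 2\<close>.\<close>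
  define D where "D t = (L'' t ** transpose (L t) + L' t ** transpose (L' t))" for t
  have dP: "((\<lambda>t. L' t ** transpose (L t)) has_vector_derivative D t) (at t within {t0..})" if "t \<ge> t0" for t
    using matrix_mult.has_vector_derivative[OF L''[OF that] has_vector_derivative_transpose[OF L'[OF that]]]
    by (simp add: D_def add.commute)
  have dP': "((\<lambda>t. L t ** transpose (L' t)) has_vector_derivative transpose (D t)) (at t within {t0..})"
    if "t \<ge> t0" for t
    using has_vector_derivative_transpose[OF dP[OF that]] by (simp add: transpose_simps)
  have contD: "continuous_on {t0..} D"
    unfolding D_def
    by (intro continuous_on_add matrix_mult.continuous_on continuous_on_transpose contL contL'')
  have dS: "(S has_vector_derivative (1/2) *\<^sub>R (D t + transpose (D t))) (at t within {t0..})"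
    if "t \<ge> t0" for t
    unfolding S_def
    by (intro bounded_linear.has_vector_derivative[OF bounded_linear_scaleR_right]
        has_vector_derivative_add dP dP' that)
  have S1: "matC_on 1 t0 S"
    by (rule matC_on_1I[OF dS]) (assumption, intro continuous_intros contD continuous_on_transpose)
  have symS: "symmetric_matrix (S t)" for t
    by (simp add: S_def symmetric_matrix_def transpose_simps add.commute)
  have \<Lambda>: "Lambda_mat t0 S S0 t = L t ** transpose (L t)" if "t \<ge> t0" for t
    using Lambda_mat_eq_mult_transpose[OF L' that] unfolding S_def[abs_def] S0_def by simp
  have symS0: "symmetric_matrix S0"
    by (simp add: S0_def symmetric_matrix_def transpose_simps)
  have pdS0: "positive_definite_matrix S0"
    unfolding positive_definite_matrix_def
  proof (intro allI impI)
    fix x :: "real^'m" assume x: "x \<noteq> 0"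
    have "x \<bullet> (S0 *v x) = (transpose (L t0) *v x) \<bullet> (transpose (L t0) *v x)"
      by (simp add: S0_def dot_lmul_matrix flip: matrix_vector_mul_assoc)
    moreover have "transpose (L t0) *v x \<noteq> 0"
    proof
      assume "transpose (L t0) *v x = 0"
      then have "transpose (matrix_inv (L t0)) *v (transpose (L t0) *v x) = 0"
        by (simp del: transpose_matrix_vector)
      then have "transpose (L t0 ** matrix_inv (L t0)) *v x = 0"
        by (simp only: matrix_vector_mul_assoc matrix_transpose_mul)
      then show False using x by (simp add: invR)
    qed
    ultimately show "x \<bullet> (S0 *v x) > 0" by (metis inner_gt_zero_iff)
  qed
  have K: "K_mat t0 A S S0 t = (1/2) *\<^sub>R (L' t ** transpose (L t) - L t ** transpose (L' t))"
    if t: "t \<ge> t0" for t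
  proof -
    have "L t ** V t = L t ** matrix_inv (L t) ** (2 *\<^sub>R L' t + A t ** L t)"
      using VL[OF t] nth_deriv_1_eq[OF L' t] by (simp add: matrix_mul_assoc)
    then have LV: "L t ** V t = 2 *\<^sub>R L' t + A t ** L t"
      using invR[OF t] by simp
    \<comment> \<open>Congruence by \<open>L\<close> preserves the symmetry of \<open>V\<close>.
      Equating \<open>2 L' L\<^sup>T + A \<Lambda>\<close> with its transpose isolates
      \<open>\<Lambda> A\<^sup>T - A \<Lambda>\<close> as four times the antisymmetric part of
      \<open>L' L\<^sup>T\<close>, whence the factor 1/4 in \<open>K_mat\<close>.\<close>
    have "transpose (L t ** V t ** transpose (L t)) = L t ** V t ** transpose (L t)"
      using V t by (simp add: transpose_simps symmetric_matrix_def matrix_mul_assoc)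
    then have "2 *\<^sub>R (L t ** transpose (L' t)) + L t ** transpose (L t) ** transpose (A t) =
        2 *\<^sub>R (L' t ** transpose (L t)) + A t ** (L t ** transpose (L t))"
      unfolding LV by (simp only: transpose_simps matrix_mult_simps matrix_mul_assoc)
    then have "L t ** transpose (L t) ** transpose (A t) - A t ** (L t ** transpose (L t)) =
        2 *\<^sub>R (L' t ** transpose (L t) - L t ** transpose (L' t))"
      by (simp only: scaleR_diff_right diff_eq_eq eq_diff_eq add_diff_eq diff_add_eq add.commute)
    then show ?thesis
      unfolding K_mat_def \<Lambda>[OF t] by simp
  qed
  have dK: "((\<lambda>t. (1/2) *\<^sub>R (L' t ** transpose (L t) - L t ** transpose (L' t))) has_vector_derivative
      (1/2) *\<^sub>R (D t - transpose (D t))) (at t within {t0..})" if "t \<ge> t0" for t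
    by (intro bounded_linear.has_vector_derivative[OF bounded_linear_scaleR_right]
        has_vector_derivative_diff dP dP' that)
  obtain \<beta> where \<beta>: "\<beta> > 0" "\<And>t. t \<ge> t0 \<Longrightarrow> norm (L t) \<le> \<beta>"
    using bL unfolding bounded_pos by auto
  have "\<exists>\<mu>>0. \<exists>\<eta>>0. \<forall>t\<ge>t0.
      \<bar>trace (Lambda_mat t0 S S0 t)\<bar> \<le> \<mu>\<^sup>2 \<and> det (Lambda_mat t0 S S0 t) \<ge> \<eta>\<^sup>2"
  proof (intro exI conjI allI impI)
    fix t assume t: "t \<ge> t0"
    show "\<bar>trace (Lambda_mat t0 S S0 t)\<bar> \<le> \<beta>\<^sup>2"
      using \<beta>(2)[OF t] by (simp add: \<Lambda>[OF t] trace_mult_transpose power_mono)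
    show "\<eta>\<^sup>2 \<le> det (Lambda_mat t0 S S0 t)"
      using \<eta>(1) \<eta>(2)[OF t] power_mono[of \<eta> "\<bar>det (L t)\<bar>" 2]
      by (simp add: \<Lambda>[OF t] det_mult_transpose)
  qed (use \<beta> \<eta> in auto)
  moreover have "bounded (nth_deriv t0 i (K_mat t0 A S S0) ` {t0..}) \<and> bounded (nth_deriv t0 i S ` {t0..})"
    if i: "i < k" for i
  proof -
    have k1: "k \<ge> 1" using i by simp
    consider "i = 0" | "i = 1" "k = 2" using i k by (auto simp: less_2_cases_iff)
    then show ?thesis
    proof cases
      case 1
      have "bounded ((\<lambda>t. (1/2) *\<^sub>R (L' t ** transpose (L t) - L t ** transpose (L' t))) ` {t0..})"
        "bounded (S ` {t0..})"
        unfolding S_def by (intro bounded_matrix_intros bL bL'[OF k1])+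
      then show ?thesis using 1 K by (simp cong: image_cong_simp)
    next
      case 2
      \<comment> \<open>The derivative of \<open>K_mat\<close> is read off from its expression in
        \<open>L\<close>, with which it agrees on the half-line.\<close>
      have "nth_deriv t0 1 (K_mat t0 A S S0) t = (1/2) *\<^sub>R (D t - transpose (D t))" if "t \<ge> t0" for t
        using nth_deriv_cong[OF K that, where n = 1] nth_deriv_1_eq[OF dK that] by simp
      moreover have "nth_deriv t0 1 S t = (1/2) *\<^sub>R (D t + transpose (D t))" if "t \<ge> t0" for t
        using nth_deriv_1_eq[OF dS that] by simp
      moreover have "bounded (D ` {t0..})"
        unfolding D_def using 2 by (intro bounded_matrix_intros bL bL'[OF k1] bL'') auto
      then have "bounded ((\<lambda>t. (1/2) *\<^sub>R (D t - transpose (D t))) ` {t0..})"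
        "bounded ((\<lambda>t. (1/2) *\<^sub>R (D t + transpose (D t))) ` {t0..})"
        by (intro bounded_matrix_intros; assumption)+
      ultimately show ?thesis unfolding 2(1) by (simp cong: image_cong_simp)
    qed
  qed
  ultimately show thesis
    using that[OF S1 _ symS0 pdS0] symS by blast
qed

text \<open>Sufficiency. \<open>L\<close> solves the linear equation with the \<open>K\<close>
  dictated by \<open>A\<close>. Boundedness of its derivatives is read off from the equation and its
  derivative, once \<open>L\<close> and the inverse of \<open>\<Lambda>\<close> are known to be
  bounded.\<close>

lemma conditions_imp_symmetric_Lk_equivalent:
  fixes A B S :: "real \<Rightarrow> real^'m^'m"
  assumes k: "k \<in> {0, 1, 2}"
    and A: "matC_on 1 t0 A" and B: "matC_on 0 t0 B" and S: "matC_on 1 t0 S"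
    and symS: "\<And>t. t \<ge> t0 \<Longrightarrow> symmetric_matrix (S t)"
    and S0: "symmetric_matrix S0" "positive_definite_matrix S0"
    and \<mu>: "\<mu> > 0" and \<eta>: "\<eta> > 0"
    and tr: "\<And>t. t \<ge> t0 \<Longrightarrow> \<bar>trace (Lambda_mat t0 S S0 t)\<bar> \<le> \<mu>\<^sup>2"
    and det: "\<And>t. t \<ge> t0 \<Longrightarrow> det (Lambda_mat t0 S S0 t) \<ge> \<eta>\<^sup>2"
    and bdd: "\<And>i. i < k \<Longrightarrow> bounded (nth_deriv t0 i (K_mat t0 A S S0) ` {t0..})"
      "\<And>i. i < k \<Longrightarrow> bounded (nth_deriv t0 i S ` {t0..})"
  obtains V W where "\<forall>t\<ge>t0. symmetric_matrix (V t)" "Lk_equivalent k t0 A B V W"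
proof -
  obtain A' where A': "\<And>t. t \<ge> t0 \<Longrightarrow> (A has_vector_derivative A' t) (at t within {t0..})"
    "continuous_on {t0..} A'" "continuous_on {t0..} A"
    using matC_on_1E[OF A] by blast
  obtain S' where S': "\<And>t. t \<ge> t0 \<Longrightarrow> (S has_vector_derivative S' t) (at t within {t0..})"
    "continuous_on {t0..} S'" "continuous_on {t0..} S"
    using matC_on_1E[OF S] by blast
  have trS: "transpose (S t) = S t" if "t \<ge> t0" for t
    using symS[OF that] by (simp add: symmetric_matrix_def)
  define \<Lambda> where "\<Lambda> = Lambda_mat t0 S S0"
  define K where "K = K_mat t0 A S S0"
  let ?I = "\<lambda>t. matrix_inv (\<Lambda> t)"
  have K_eq: "K t = (1/4) *\<^sub>R (\<Lambda> t ** transpose (A t) - A t ** \<Lambda> t)" for t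
    by (simp add: K_def \<Lambda>_def K_mat_def)
  have d\<Lambda>: "(\<Lambda> has_vector_derivative 2 *\<^sub>R S t) (at t within {t0..})" if "t \<ge> t0" for t
    unfolding \<Lambda>_def using S'(3) that by (rule Lambda_mat_has_vector_derivative)
  have cont\<Lambda>: "continuous_on {t0..} \<Lambda>"
    using d\<Lambda> by (intro continuous_on_vector_derivative[where f' = "\<lambda>t. 2 *\<^sub>R S t"]) auto
  have nz: "det (\<Lambda> t) \<noteq> 0" if "t \<ge> t0" for t
    using det[OF that] \<eta> zero_less_power[of \<eta> 2] unfolding \<Lambda>_def by linarith
  have sym\<Lambda>: "transpose (\<Lambda> t) = \<Lambda> t" for t
    unfolding \<Lambda>_def using S0(1)
    by (intro transpose_Lambda_mat S'(3) trS) (auto simp: symmetric_matrix_def)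
  have antiK: "transpose (K t) = - K t" for t
    by (simp add: K_eq transpose_simps sym\<Lambda> flip: scaleR_minus_right)
  \<comment> \<open>Here the continuous derivative of \<open>A\<close> enters: it makes the
    coefficient of the linear equation continuously differentiable, which puts \<open>L\<close> in
    class C^2.\<close>
  define K' where "K' t = (1/4) *\<^sub>R ((\<Lambda> t ** transpose (A' t) + (2 *\<^sub>R S t) ** transpose (A t)) -
      (A t ** (2 *\<^sub>R S t) + A' t ** \<Lambda> t))" for t
  have dK: "(K has_vector_derivative K' t) (at t within {t0..})" if "t \<ge> t0" for t
    unfolding K_eq[abs_def] K'_def
    by (intro bounded_linear.has_vector_derivative[OF bounded_linear_scaleR_right]
        has_vector_derivative_diff matrix_mult.has_vector_derivative has_vector_derivative_transpose
        A'(1) d\<Lambda> that)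
  have contK': "continuous_on {t0..} K'"
    unfolding K'_def
    by (intro continuous_intros matrix_mult.continuous_on continuous_on_transpose A' S' cont\<Lambda>)
  have contK: "continuous_on {t0..} K"
    using dK by (intro continuous_on_vector_derivative[of _ K K']) auto
  obtain L0 :: "real^'m^'m" where L0: "L0 ** transpose L0 = S0"
    using symmetric_positive_definite_factor[OF S0] .
  have \<Lambda>t0: "L0 ** transpose L0 = \<Lambda> t0" by (simp add: L0 \<Lambda>_def Lambda_mat_def)
  obtain L :: "real \<Rightarrow> real^'m^'m" where "L t0 = L0" and
    L': "\<And>t. t \<ge> t0 \<Longrightarrow> (L has_vector_derivative (S t + K t) ** ?I t ** L t) (at t within {t0..})"
    and LL: "\<And>t. t \<ge> t0 \<Longrightarrow> L t ** transpose (L t) = \<Lambda> t"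
    by (rule matrix_ode_factor_exists[of t0 \<Lambda> S K L0])
      (rule d\<Lambda> S'(3) contK sym\<Lambda> trS antiK nz \<Lambda>t0 | assumption | blast)+
  define L1 where "L1 t = (S t + K t) ** ?I t ** L t" for t
  define I' where "I' t = - (?I t ** (2 *\<^sub>R S t) ** ?I t)" for t
  \<comment> \<open>This is the product rule for \<open>L1\<close>, with \<open>I'\<close> the
    derivative of the inverse of \<open>\<Lambda>\<close>. Beyond the factors already bounded for
    \<open>L1\<close>, only \<open>S'\<close> and \<open>K'\<close> occur, and condition (2)
    controls them when \<open>k = 2\<close>.\<close>
  define L2 where "L2 t = (S t + K t) ** ?I t ** L1 t +
      ((S t + K t) ** I' t + (S' t + K' t) ** ?I t) ** L t" for t
  have dL: "(L has_vector_derivative L1 t) (at t within {t0..})" if "t \<ge> t0" for t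
    using L'[OF that] by (simp add: L1_def)
  have dI: "(?I has_vector_derivative I' t) (at t within {t0..})" if "t \<ge> t0" for t
    unfolding I'_def using that
    by (intro has_vector_derivative_matrix_inv d\<Lambda> cont\<Lambda> nz) auto
  have dL1: "(L1 has_vector_derivative L2 t) (at t within {t0..})" if "t \<ge> t0" for t
    unfolding L1_def[abs_def] L2_def
    by (intro matrix_mult.has_vector_derivative has_vector_derivative_add
        dL[unfolded L1_def] S'(1) dK dI that)
  have contI: "continuous_on {t0..} ?I"
    using nz by (intro continuous_on_matrix_inv cont\<Lambda>) auto
  have contL: "continuous_on {t0..} L" "continuous_on {t0..} L1"
    using dL dL1 by (auto intro: continuous_on_vector_derivative[of _ L L1] continuous_on_vector_derivative[of _ L1 L2])
  have contL2: "continuous_on {t0..} L2"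
    unfolding L2_def I'_def
    by (intro continuous_intros matrix_mult.continuous_on contL contI S' contK contK')
  have L_C2: "matC_on 2 t0 L"
    unfolding matC_on_2_iff using dL dL1 contL2 by blast
  have detL: "\<bar>det (L t)\<bar> \<ge> \<eta>" if "t \<ge> t0" for t
  proof -
    have "\<eta>\<^sup>2 \<le> \<bar>det (L t)\<bar>\<^sup>2"
      using det[OF that] by (simp add: det_mult_transpose flip: LL[OF that] \<Lambda>_def)
    then show ?thesis by (rule power2_le_imp_le) simp
  qed
  then have nzL: "det (L t) \<noteq> 0" if "t \<ge> t0" for t
    using that \<eta> by fastforce
  have "norm (L t) \<le> \<mu>" if "t \<ge> t0" for t
  proof -
    have "(norm (L t))\<^sup>2 \<le> \<mu>\<^sup>2"
      using tr[OF that] by (simp add: trace_mult_transpose flip: LL[OF that] \<Lambda>_def)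
    then show ?thesis using \<mu> by (rule power2_le_imp_le[OF _ less_imp_le])
  qed
  then have bL: "bounded (L ` {t0..})" by (auto simp: bounded_iff)
  then have "bounded ((\<lambda>t. L t ** transpose (L t)) ` {t0..})"
    by (intro bounded_matrix_intros)
  then have b\<Lambda>: "bounded (\<Lambda> ` {t0..})" using LL by (simp cong: image_cong_simp)
  \<comment> \<open>The determinant bound in condition (1) keeps the bounded path
    \<open>\<Lambda>\<close> away from singular matrices.\<close>
  have bI: "bounded (?I ` {t0..})"
    using \<eta> by (intro bounded_matrix_inv[OF b\<Lambda>, of "\<eta>\<^sup>2"])
      (auto simp: \<Lambda>_def intro: order_trans[OF det])
  have bS: "bounded (S ` {t0..})" "bounded (K ` {t0..})" if "k \<ge> 1"
    using bdd[of 0] that by (auto simp: K_def)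
  have bL1: "bounded (L1 ` {t0..})" if "k \<ge> 1"
    unfolding L1_def by (intro bounded_matrix_intros bS[OF that] bI bL)
  have bL2: "bounded (L2 ` {t0..})" if k2: "k \<ge> 2"
  proof -
    have "bounded (S' ` {t0..})" "bounded (K' ` {t0..})"
      using bdd[of 1] k2 nth_deriv_1_eq[OF S'(1)] nth_deriv_1_eq[OF dK]
      by (auto simp: K_def cong: image_cong_simp)
    with k2 show ?thesis
      unfolding L2_def I'_def by (intro bounded_matrix_intros bS bI bL bL1) auto
  qed
  have "bounded (nth_deriv t0 i L ` {t0..})" if i: "i \<le> k" for i
  proof -
    consider "i = 0" | "i = 1" "k \<ge> 1" | "i = 2" "k \<ge> 2"
      using i k by (auto simp: le_Suc_eq numeral_2_eq_2)
    then show ?thesis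
      using bL bL1 bL2 nth_deriv_1_eq[OF dL] nth_deriv_2_eq[OF dL dL1]
      by cases (simp_all cong: image_cong_simp)
  qed
  \<comment> \<open>Halving turns the bound \<open>\<bar>det (L t)\<bar> \<ge> \<eta>\<close> into
    the strict one that \<open>Lk_matrix\<close> demands.\<close>
  moreover have "\<exists>\<eta>>0. \<forall>t\<ge>t0. \<bar>det (L t)\<bar> > \<eta>"
    using \<eta> detL by (intro exI[of _ "\<eta> / 2"]) fastforce
  ultimately have LkL: "Lk_matrix k t0 L"
    using L_C2 unfolding Lk_matrix_def bdd_above_norm_iff by simp
  let ?J = "\<lambda>t. matrix_inv (L t)"
  define V where "V t = ?J t ** (2 *\<^sub>R L1 t + A t ** L t)" for t
  define W where "W t = ?J t ** (L2 t + A t ** L1 t + B t ** L t)" for t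
  have contJ: "continuous_on {t0..} ?J"
    using nzL by (intro continuous_on_matrix_inv contL) auto
  have contB: "continuous_on {t0..} B"
    using B by (simp add: matC_on_0_iff)
  have "continuous_on {t0..} V" "continuous_on {t0..} W"
    unfolding V_def W_def
    by (intro continuous_intros matrix_mult.continuous_on contJ contL contL2 A' contB)+
  then have "Lk_equivalent k t0 A B V W"
    unfolding Lk_equivalent_def matC_on_0_iff using LkL A'(3) contB
    by (auto simp: V_def W_def nth_deriv_1_eq[OF dL] nth_deriv_2_eq[OF dL dL1]
        simp del: One_nat_def intro!: exI[of _ L])
  moreover have "symmetric_matrix (V t)" if t: "t \<ge> t0" for t
  proof -
    have "transpose (L t) ** transpose (?J t) = mat 1"
      using matrix_inv_mult_left[OF nzL[OF t]] by (simp flip: matrix_transpose_mul)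
    \<comment> \<open>Substituting this on the right of \<open>2 L' + A L\<close> exhibits
      \<open>V\<close> as a congruence \<open>J N J\<^sup>T\<close>, with \<open>J\<close> the
      inverse of \<open>L\<close>, so only the middle factor \<open>N\<close> has to be
      symmetric.\<close>
    then have L_eq: "L t = \<Lambda> t ** transpose (?J t)"
      by (simp flip: LL[OF t] matrix_mul_assoc)
    have "2 *\<^sub>R L1 t + A t ** L t = (2 *\<^sub>R (S t + K t) ** ?I t + A t) ** L t"
      by (simp only: L1_def matrix_mult_simps)
    also have "\<dots> = (2 *\<^sub>R (S t + K t) ** (?I t ** \<Lambda> t) + A t ** \<Lambda> t) ** transpose (?J t)"
      by (subst L_eq) (simp only: matrix_mult_simps matrix_mul_assoc)
    also have "\<dots> = (2 *\<^sub>R S t + (1/2) *\<^sub>R (\<Lambda> t ** transpose (A t) + A t ** \<Lambda> t)) ** transpose (?J t)"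
    proof -
      \<comment> \<open>\<open>2 K\<close> cancels exactly the antisymmetric part of
        \<open>A \<Lambda>\<close>, leaving its symmetric part.\<close>
      have "2 *\<^sub>R K t + A t ** \<Lambda> t = (1/2) *\<^sub>R (\<Lambda> t ** transpose (A t) + A t ** \<Lambda> t)"
        unfolding K_eq by (simp add: vec_eq_iff field_simps)
      then show ?thesis
        by (simp add: matrix_inv_mult_left[OF nz[OF t]] scaleR_add_right add.assoc)
    qed
    finally have "V t = ?J t ** (2 *\<^sub>R S t + (1/2) *\<^sub>R (\<Lambda> t ** transpose (A t) + A t ** \<Lambda> t)) ** transpose (?J t)"
      by (simp add: V_def matrix_mul_assoc)
    then show ?thesis
      by (simp add: symmetric_matrix_def transpose_simps trS[OF t] sym\<Lambda> matrix_mul_assoc add.commute)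
  qed
  ultimately show thesis using that by blast
qed

theorem theorem2:
  fixes A B :: "real \<Rightarrow> real^'m^'m" and t0 :: real and k :: nat
  assumes "k \<in> {0, 1, 2}"
    and "matC_on 1 t0 A"
    and "matC_on 0 t0 B"
  shows "(\<exists>V W. (\<forall>t\<ge>t0. symmetric_matrix (V t)) \<and> Lk_equivalent k t0 A B V W) \<longleftrightarrow>
    (\<exists>S S0. matC_on 1 t0 S \<and> (\<forall>t\<ge>t0. symmetric_matrix (S t)) \<and>
       symmetric_matrix S0 \<and> positive_definite_matrix S0 \<and>
       (\<exists>\<mu>>0. \<exists>\<eta>>0. \<forall>t\<ge>t0.
          \<bar>2 * integral {t0..t} (\<lambda>\<nu>. trace (S \<nu>)) + trace S0\<bar> \<le> \<mu>\<^sup>2 \<and>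
          det (2 *\<^sub>R integral {t0..t} S + S0) \<ge> \<eta>\<^sup>2) \<and>
       (k \<noteq> 0 \<longrightarrow> (\<forall>i\<in>{0..k-1}.
          bdd_above ((\<lambda>t. norm (nth_deriv t0 i (K_mat t0 A S S0) t)) ` {t0..}) \<and>
          bdd_above ((\<lambda>t. norm (nth_deriv t0 i S t)) ` {t0..}))))"
proof -
  have trace_eq: "2 * integral {t0..t} (\<lambda>\<nu>. trace (S \<nu>)) + trace S0 = trace (Lambda_mat t0 S S0 t)"
    if "matC_on 1 t0 S" for t and S :: "real \<Rightarrow> real^'m^'m" and S0
    by (rule matC_on_1E[OF that]) (rule trace_Lambda_mat)
  \<comment> \<open>For \<open>k = 0\<close> truncated subtraction would leave the index 0 in
    \<open>{0..k-1}\<close>; the guard \<open>k \<noteq> 0\<close> removes it, so both sides range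
    over \<open>i < k\<close>.\<close>
  have less_k: "(k \<noteq> 0 \<longrightarrow> (\<forall>i\<in>{0..k-1}. P i)) \<longleftrightarrow> (\<forall>i<k. P i)" for P
    by (cases k) (auto simp: less_Suc_eq_le)
  show ?thesis
    unfolding less_k bdd_above_norm_iff Lambda_mat_def[symmetric]
  proof (intro iffI; elim exE conjE)
    fix V W
    assume V: "\<forall>t\<ge>t0. symmetric_matrix (V t)" and equiv: "Lk_equivalent k t0 A B V W"
    obtain S S0 where S: "matC_on 1 t0 S" and "\<forall>t\<ge>t0. symmetric_matrix (S t)"
      "symmetric_matrix S0" "positive_definite_matrix S0"
      "\<exists>\<mu>>0. \<exists>\<eta>>0. \<forall>t\<ge>t0.
        \<bar>trace (Lambda_mat t0 S S0 t)\<bar> \<le> \<mu>\<^sup>2 \<and> det (Lambda_mat t0 S S0 t) \<ge> \<eta>\<^sup>2"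
      "\<forall>i<k. bounded (nth_deriv t0 i (K_mat t0 A S S0) ` {t0..}) \<and> bounded (nth_deriv t0 i S ` {t0..})"
      by (rule symmetric_Lk_equivalent_imp_conditions[OF assms(1) V equiv])
    then show "\<exists>S S0. matC_on 1 t0 S \<and> (\<forall>t\<ge>t0. symmetric_matrix (S t)) \<and>
       symmetric_matrix S0 \<and> positive_definite_matrix S0 \<and>
       (\<exists>\<mu>>0. \<exists>\<eta>>0. \<forall>t\<ge>t0.
          \<bar>2 * integral {t0..t} (\<lambda>\<nu>. trace (S \<nu>)) + trace S0\<bar> \<le> \<mu>\<^sup>2 \<and>
          det (Lambda_mat t0 S S0 t) \<ge> \<eta>\<^sup>2) \<and>
       (\<forall>i<k. bounded (nth_deriv t0 i (K_mat t0 A S S0) ` {t0..}) \<and> bounded (nth_deriv t0 i S ` {t0..}))"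
      by (intro exI[of _ S] exI[of _ S0] conjI) (simp_all only: trace_eq[OF S])
  next
    fix S S0 \<mu> \<eta>
    assume S: "matC_on 1 t0 S" and *: "\<forall>t\<ge>t0. symmetric_matrix (S t)"
      "symmetric_matrix S0" "positive_definite_matrix S0" "0 < \<mu>" "0 < \<eta>"
      "\<forall>t\<ge>t0. \<bar>2 * integral {t0..t} (\<lambda>\<nu>. trace (S \<nu>)) + trace S0\<bar> \<le> \<mu>\<^sup>2 \<and>
          det (Lambda_mat t0 S S0 t) \<ge> \<eta>\<^sup>2"
      "\<forall>i<k. bounded (nth_deriv t0 i (K_mat t0 A S S0) ` {t0..}) \<and> bounded (nth_deriv t0 i S ` {t0..})"
    show "\<exists>V W. (\<forall>t\<ge>t0. symmetric_matrix (V t)) \<and> Lk_equivalent k t0 A B V W"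
    proof (rule conditions_imp_symmetric_Lk_equivalent[OF assms S, of S0 \<mu> \<eta>])
      fix V W
      assume "\<forall>t\<ge>t0. symmetric_matrix (V t)" "Lk_equivalent k t0 A B V W"
      then show ?thesis by blast
    qed (use * in \<open>auto simp: trace_eq[OF S]\<close>)
  qed
qed

end
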